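(* Let $e\ge 2$ be an integer, let $\gamma=(\gamma_1,\ldots,\gamma_{e-1})\in\mathbb{Q}^{e-1}$ with $1\le\gamma_1\le\ldots\le\gamma_{e-1}$, and let $B\ne\{0\}$ be a finite nonempty subset of $\mathbb{N}^{e-1}$ whose complement $C=\mathbb{N}^{e-1}\setminus B$ satisfies $C+\mathbb{N}^{e-1}\subseteq C$. Let $w(\gamma,B)$ be the Wilf ratio and $t(R(B))$ the Cohen-Macaulay type of $R(B)$ (both defined in the context). Then: a) $\displaystyle w(\gamma,B)\ge\frac{1}{t(R(B))}$. b) If $B$ is a cuboid, i.e. $B=Q_m$ for some $m\in\mathbb{N}^{e-1}$, then $w(\gamma,B)=1$.
   Context: $\mathbb{N}=\{0,1,2,\ldots\}$. $\mathbb{Z}^{e-1}$ is partially ordered by $x\ge y$ iff $x-y\in\mathbb{N}^{e-1}$, and $x\cdot\gamma$ is the dot product. For $m\in\mathbb{N}^{e-1}$ the cuboid is $Q_m:=\{b\in\mathbb{N}^{e-1}\mid b\le m\}$. $R(B):=\mathbb{C}[X_1,\ldots,X_{e-1}]/I(C)$, where $I(C)$ is the ideal generated by the monomials $\underline{X}^c=X_1^{c_1}\cdots X_{e-1}^{c_{e-1}}$, $c\in C$. This is a local artinian ring; its Cohen-Macaulay type $t(R(B))$ is the $\mathbb{C}$-dimension of its socle, which equals the number of maximal elements of $B$ with respect to $\le$. Wilf ratio: put $\max(B\cdot\gamma):=\max\{b\cdot\gamma\mid b\in B\}$, $n_0:=n_0(\gamma,B):=\lfloor\max(B\cdot\gamma)\rfloor$,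 and for $n=0,\ldots,n_0$ $$h_n:=\#\{b\in B\mid \lfloor b\cdot\gamma\rfloor=n\},\qquad h_n':=\#\{b\in B\mid n_0-\lfloor\max(B\cdot\gamma)-b\cdot\gamma\rfloor=n\}.$$ Then $$w(\gamma,B):=\frac{n_0h_0'+(n_0-1)h_1'+\ldots+0\cdot h_{n_0}'}{0\cdot h_0+1\cdot h_1+\ldots+n_0h_{n_0}}.$$ *)

theory Defs
  imports "HOL-Algebra.Embedded_Algebras" "HOL-Algebra.QuotRing" "HOL-Library.Poly_Mapping"
    Complex_Main
begin

text \<open>Vectors of length \<open>e - 1\<close> over the naturals are functions with support in
  \<open>{1..e-1}\<close>, so that they double as exponents of monomials. The library order on
  \<open>\<Rightarrow>\<^sub>0\<close> is lexicographic; the componentwise order is the separate relation \<open>vle\<close>.\<close>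

definition nvec :: "nat \<Rightarrow> (nat \<Rightarrow>\<^sub>0 nat) set" where
  "nvec e = {v. Poly_Mapping.keys v \<subseteq> {1..e-1}}"

definition vle :: "nat \<Rightarrow> (nat \<Rightarrow>\<^sub>0 nat) \<Rightarrow> (nat \<Rightarrow>\<^sub>0 nat) \<Rightarrow> bool" where
  "vle e x y \<longleftrightarrow> (\<forall>i\<in>{1..e-1}. Poly_Mapping.lookup x i \<le> Poly_Mapping.lookup y i)"

definition cuboid :: "nat \<Rightarrow> (nat \<Rightarrow>\<^sub>0 nat) \<Rightarrow> (nat \<Rightarrow>\<^sub>0 nat) set" where
  "cuboid e m = {b \<in> nvec e. vle e b m}"

definition dotp :: "nat \<Rightarrow> (nat \<Rightarrow> rat) \<Rightarrow> (nat \<Rightarrow>\<^sub>0 nat) \<Rightarrow> rat" where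
  "dotp e \<gamma> x = (\<Sum>i=1..e-1. of_nat (Poly_Mapping.lookup x i) * \<gamma> i)"

definition max_dot :: "nat \<Rightarrow> (nat \<Rightarrow> rat) \<Rightarrow> (nat \<Rightarrow>\<^sub>0 nat) set \<Rightarrow> rat" where
  "max_dot e \<gamma> B = Max (dotp e \<gamma> ` B)"

definition wilf_n0 :: "nat \<Rightarrow> (nat \<Rightarrow> rat) \<Rightarrow> (nat \<Rightarrow>\<^sub>0 nat) set \<Rightarrow> nat" where
  "wilf_n0 e \<gamma> B = nat \<lfloor>max_dot e \<gamma> B\<rfloor>"

definition wilf_h :: "nat \<Rightarrow> (nat \<Rightarrow> rat) \<Rightarrow> (nat \<Rightarrow>\<^sub>0 nat) set \<Rightarrow> nat \<Rightarrow> nat" where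
  "wilf_h e \<gamma> B n = card {b \<in> B. \<lfloor>dotp e \<gamma> b\<rfloor> = int n}"

definition wilf_h' :: "nat \<Rightarrow> (nat \<Rightarrow> rat) \<Rightarrow> (nat \<Rightarrow>\<^sub>0 nat) set \<Rightarrow> nat \<Rightarrow> nat" where
  "wilf_h' e \<gamma> B n =
     card {b \<in> B. int (wilf_n0 e \<gamma> B) - \<lfloor>max_dot e \<gamma> B - dotp e \<gamma> b\<rfloor> = int n}"

definition wilf_ratio :: "nat \<Rightarrow> (nat \<Rightarrow> rat) \<Rightarrow> (nat \<Rightarrow>\<^sub>0 nat) set \<Rightarrow> rat" where
  "wilf_ratio e \<gamma> B =
     of_nat (\<Sum>n=0..wilf_n0 e \<gamma> B. (wilf_n0 e \<gamma> B - n) * wilf_h' e \<gamma> B n) /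
     of_nat (\<Sum>n=0..wilf_n0 e \<gamma> B. n * wilf_h e \<gamma> B n)"

text \<open>A polynomial maps each exponent vector to its coefficient; \<open>*\<close> on \<open>\<Rightarrow>\<^sub>0\<close> is convolution.\<close>

definition poly_ring :: "nat \<Rightarrow> ((nat \<Rightarrow>\<^sub>0 nat) \<Rightarrow>\<^sub>0 complex) ring" where
  "poly_ring e =
     \<lparr>carrier = {p. Poly_Mapping.keys p \<subseteq> nvec e}, mult = (*), one = 1, zero = 0, add = (+)\<rparr>"

lemma cring_poly_ring: "cring (poly_ring e)"
proof -
  have add: "p + q \<in> carrier (poly_ring e)"
    if "p \<in> carrier (poly_ring e)" "q \<in> carrier (poly_ring e)" for p q
    using that Poly_Mapping.keys_add[of p q] by (auto simp: poly_ring_def)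
  have nv: "a + b \<in> nvec e" if "a \<in> nvec e" "b \<in> nvec e" for a b
    using that Poly_Mapping.keys_add[of a b] by (auto simp: nvec_def)
  have mult: "p * q \<in> carrier (poly_ring e)"
    if "p \<in> carrier (poly_ring e)" "q \<in> carrier (poly_ring e)" for p q
    using that keys_mult[of p q] nv by (fastforce simp: poly_ring_def)
  have neg: "- p \<in> carrier (poly_ring e)" if "p \<in> carrier (poly_ring e)" for p
    using that by (simp add: poly_ring_def)
  have one: "1 \<in> carrier (poly_ring e)"
    by (auto simp: poly_ring_def nvec_def simp flip: single_one)
  show ?thesis
  proof (rule cringI)
    show "abelian_group (poly_ring e)"
    proof (rule abelian_groupI)
      fix x assume "x \<in> carrier (poly_ring e)"
      then show "\<exists>y\<in>carrier (poly_ring e). y \<oplus>\<^bsub>poly_ring e\<^esub> x = \<zero>\<^bsub>poly_ring e\<^esub>"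
        using neg by (intro bexI[of _ "- x"]) (auto simp: poly_ring_def)
    qed (use add in \<open>auto simp: poly_ring_def ac_simps\<close>)
    show "comm_monoid (poly_ring e)"
      by (rule comm_monoidI) (use mult one in \<open>auto simp: poly_ring_def ac_simps\<close>)
  qed (auto simp: poly_ring_def algebra_simps)
qed

definition mono_ideal :: "nat \<Rightarrow> (nat \<Rightarrow>\<^sub>0 nat) set \<Rightarrow> ((nat \<Rightarrow>\<^sub>0 nat) \<Rightarrow>\<^sub>0 complex) set" where
  "mono_ideal e C = Idl\<^bsub>poly_ring e\<^esub> ((\<lambda>c. Poly_Mapping.single c 1) ` C)"

definition RB :: "nat \<Rightarrow> (nat \<Rightarrow>\<^sub>0 nat) set \<Rightarrow> ((nat \<Rightarrow>\<^sub>0 nat) \<Rightarrow>\<^sub>0 complex) set ring" where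
  "RB e B = poly_ring e Quot mono_ideal e (nvec e - B)"

text \<open>The copy of the complex numbers in the quotient: the classes of the constant polynomials.\<close>

definition RB_scalars :: "nat \<Rightarrow> (nat \<Rightarrow>\<^sub>0 nat) set \<Rightarrow> ((nat \<Rightarrow>\<^sub>0 nat) \<Rightarrow>\<^sub>0 complex) set set" where
  "RB_scalars e B =
     range (\<lambda>a. mono_ideal e (nvec e - B) +>\<^bsub>poly_ring e\<^esub> Poly_Mapping.single 0 a)"

text \<open>For a commutative artinian ring the socle is the annihilator of the Jacobson radical; for a
  local one this is the annihilator of its maximal ideal.\<close>

definition jacobson_radical :: "('a, 'b) ring_scheme \<Rightarrow> 'a set" where
  "jacobson_radical R = carrier R \<inter> \<Inter>{M. maximalideal M R}"

definition socle :: "('a, 'b) ring_scheme \<Rightarrow> 'a set" where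
  "socle R = {x \<in> carrier R. \<forall>a\<in>jacobson_radical R. a \<otimes>\<^bsub>R\<^esub> x = \<zero>\<^bsub>R\<^esub>}"

definition cm_type :: "nat \<Rightarrow> (nat \<Rightarrow>\<^sub>0 nat) set \<Rightarrow> nat" where
  "cm_type e B = (ring.dim (RB e B) over RB_scalars e B) (socle (RB e B))"

end

theory Submission
  imports Defs
begin

text \<open>Grouping the summands of the Wilf ratio by \<open>b \<in> B\<close> turns it into
  \<open>(\<Sum>b\<in>B. \<lfloor>max(B\<cdot>\<gamma>) - b\<cdot>\<gamma>\<rfloor>) / (\<Sum>b\<in>B. \<lfloor>b\<cdot>\<gamma>\<rfloor>)\<close>. On a cuboid \<open>Q\<^sub>m\<close> the reflection
  \<open>b \<mapsto> m - b\<close> exchanges the two sums. In general \<open>B\<close> is the union of the cuboids \<open>Q\<^sub>m\<close> over the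
  maximal elements \<open>m\<close> of \<open>B\<close>, and for each of them the reflection bounds
  \<open>\<Sum>b\<in>Q\<^sub>m. \<lfloor>b\<cdot>\<gamma>\<rfloor>\<close> by the numerator. So the denominator is at most the number of maximal
  elements times the numerator. Finally, the monomials of the maximal elements are linearly
  independent elements of the socle, so there are at most \<open>t(R(B))\<close> of them.\<close>

section \<open>Order ideals of exponent vectors\<close>

lemma lookup_nvec: "x \<in> nvec e \<Longrightarrow> i \<notin> {1..e-1} \<Longrightarrow> Poly_Mapping.lookup x i = 0"
  by (auto simp: nvec_def in_keys_iff subset_iff)

lemma nvec_iff: "x \<in> nvec e \<longleftrightarrow> (\<forall>i. i \<notin> {1..e-1} \<longrightarrow> Poly_Mapping.lookup x i = 0)"
  by (auto simp: nvec_def in_keys_iff subset_iff)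

lemma nvec_add: "x \<in> nvec e \<Longrightarrow> y \<in> nvec e \<Longrightarrow> x + y \<in> nvec e"
  by (simp add: nvec_iff lookup_add)

lemma nvec_diff: "x \<in> nvec e \<Longrightarrow> x - y \<in> nvec e"
  by (simp add: nvec_iff lookup_minus)

lemma zero_in_nvec: "0 \<in> nvec e"
  by (simp add: nvec_iff)

lemma vle_refl: "vle e x x"
  by (simp add: vle_def)

lemma vle_trans: "vle e x y \<Longrightarrow> vle e y z \<Longrightarrow> vle e x z"
  unfolding vle_def using order_trans by blast

text \<open>\<open>vle\<close> compares only the coordinates in \<open>{1..e-1}\<close>; all others
  vanish on \<open>nvec e\<close>, which is why membership is assumed.\<close>

lemma vle_antisym:
  assumes "x \<in> nvec e" "y \<in> nvec e" "vle e x y" "vle e y x"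
  shows "x = y"
proof (rule poly_mapping_eqI)
  fix i show "Poly_Mapping.lookup x i = Poly_Mapping.lookup y i"
    using assms by (cases "i \<in> {1..e-1}") (auto simp: vle_def lookup_nvec intro: order_antisym)
qed

lemma vle_diff: "vle e (x - y) x"
  by (simp add: vle_def lookup_minus)

text \<open>Subtraction of exponents truncates at 0 in each coordinate; below \<open>y\<close>
  nothing is cut off.\<close>

lemma vle_add_diff:
  assumes "x \<in> nvec e" "y \<in> nvec e" "vle e x y"
  shows "x + (y - x) = y"
proof (rule poly_mapping_eqI)
  fix i show "Poly_Mapping.lookup (x + (y - x)) i = Poly_Mapping.lookup y i"
    using assms by (cases "i \<in> {1..e-1}") (auto simp: vle_def lookup_nvec lookup_add lookup_minus)
qed

lemma vle_add_right: "vle e x (x + y)"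
  by (simp add: vle_def lookup_add)

lemma vle_diff_diff:
  assumes "x \<in> nvec e" "y \<in> nvec e" "vle e x y"
  shows "y - (y - x) = x"
proof (rule poly_mapping_eqI)
  fix i show "Poly_Mapping.lookup (y - (y - x)) i = Poly_Mapping.lookup x i"
    using assms by (cases "i \<in> {1..e-1}") (auto simp: vle_def lookup_nvec lookup_minus)
qed

text \<open>The reflection is its own inverse, because \<open>m - (m - b) = b\<close> whenever
  \<open>b\<close> lies below \<open>m\<close>.\<close>

lemma bij_betw_cuboid_reflect:
  assumes "m \<in> nvec e"
  shows "bij_betw (\<lambda>b. m - b) (cuboid e m) (cuboid e m)"
  by (rule bij_betw_byWitness[where f' = "\<lambda>b. m - b"])
    (use assms in \<open>auto simp: cuboid_def vle_diff nvec_diff vle_diff_diff\<close>)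

section \<open>Finite order ideals and their maximal elements\<close>

locale order_ideal =
  fixes e :: nat and B :: "(nat \<Rightarrow>\<^sub>0 nat) set"
  assumes subset: "B \<subseteq> nvec e" and fin: "finite B" and nonempty: "B \<noteq> {}"
    and compl_closed: "c \<in> nvec e - B \<Longrightarrow> v \<in> nvec e \<Longrightarrow> c + v \<in> nvec e - B"
begin

text \<open>If \<open>x\<close> were in the complement, adding \<open>b - x\<close> would keep it
  there, but the result is \<open>b\<close>.\<close>

lemma down_closed:
  assumes "b \<in> B" "x \<in> nvec e" "vle e x b"
  shows "x \<in> B"
proof (rule ccontr)
  assume "x \<notin> B"
  then have "x + (b - x) \<in> nvec e - B"
    using assms subset by (intro compl_closed) (auto intro: nvec_diff)
  then show False
    using assms subset vle_add_diff[of x e b] by auto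
qed

lemma zero_mem: "0 \<in> B"
proof -
  obtain b where "b \<in> B" using nonempty by blast
  then show ?thesis by (rule down_closed) (auto simp: zero_in_nvec vle_def)
qed

definition maximals :: "(nat \<Rightarrow>\<^sub>0 nat) set" where
  "maximals = {m \<in> B. \<forall>b\<in>B. vle e m b \<longrightarrow> b = m}"

lemma maximals_subset: "maximals \<subseteq> B"
  by (auto simp: maximals_def)

lemma finite_maximals: "finite maximals"
  using maximals_subset fin finite_subset by blast

text \<open>The elements of \<open>B\<close> above \<open>b\<close> form a finite nonempty set; a
  maximal one among them is maximal in all of \<open>B\<close> by transitivity.\<close>

lemma below_maximal:
  assumes "b \<in> B"
  obtains m where "m \<in> maximals" "vle e b m"
proof -
  let ?A = "{x \<in> B. vle e b x}" and ?R = "\<lambda>x y. vle e x y \<and> x \<noteq> y"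
  have "asymp_on ?A ?R"
    using subset vle_antisym by (intro asymp_onI) blast
  \<comment> \<open>Antisymmetry enters since a chain of two strict steps must not return to its
    start.\<close>
  moreover have "transp_on ?A ?R"
    using subset vle_antisym vle_trans by (intro transp_onI) blast
  ultimately obtain m where m: "m \<in> ?A" "\<forall>x\<in>?A. x \<noteq> m \<longrightarrow> \<not> ?R m x"
    using Finite_Set.bex_max_element[of ?A ?R] assms fin vle_refl by auto
  then have "m \<in> maximals"
    unfolding maximals_def using vle_trans by blast
  with m that show ?thesis by blast
qed

lemma cuboid_subset: "m \<in> B \<Longrightarrow> cuboid e m \<subseteq> B"
  by (auto simp: cuboid_def intro: down_closed)

lemma Union_cuboids: "(\<Union>m\<in>maximals. cuboid e m) = B"
proof
  show "(\<Union>m\<in>maximals. cuboid e m) \<subseteq> B"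
    using cuboid_subset maximals_subset by blast
  show "B \<subseteq> (\<Union>m\<in>maximals. cuboid e m)"
  proof
    fix b assume "b \<in> B"
    then obtain m where "m \<in> maximals" "vle e b m" by (rule below_maximal)
    with \<open>b \<in> B\<close> subset show "b \<in> (\<Union>m\<in>maximals. cuboid e m)"
      by (auto simp: cuboid_def)
  qed
qed

text \<open>In the quotient ring this makes every nonconstant monomial annihilate the monomial of a
  maximal element.\<close>

lemma add_maximal_notin:
  assumes "m \<in> maximals" "v \<noteq> 0"
  shows "m + v \<notin> B"
  using assms vle_add_right[of e m v] by (auto simp: maximals_def)

end

section \<open>The Wilf ratio as a quotient of two sums over \<open>B\<close>\<close>

lemma sum_card_fibres:
  fixes g :: "nat \<Rightarrow> nat"
  assumes "finite B" and "\<And>b. b \<in> B \<Longrightarrow> f b \<le> N"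
  shows "(\<Sum>n=0..N. g n * card {b \<in> B. f b = n}) = (\<Sum>b\<in>B. g (f b))"
proof -
  have "(\<Sum>b\<in>B. g (f b)) = (\<Sum>n=0..N. \<Sum>b\<in>{b \<in> B. f b = n}. g (f b))"
    using assms by (intro sum.group[symmetric]) auto
  also have "\<dots> = (\<Sum>n=0..N. g n * card {b \<in> B. f b = n})"
    by (intro sum.cong) auto
  finally show ?thesis ..
qed

text \<open>Points in overlaps are counted repeatedly on the right, which can only increase a sum of
  naturals.\<close>

lemma sum_UN_le_sum:
  fixes f :: "'a \<Rightarrow> nat"
  assumes "finite I" and "\<And>i. i \<in> I \<Longrightarrow> finite (A i)"
  shows "sum f (\<Union>i\<in>I. A i) \<le> (\<Sum>i\<in>I. sum f (A i))"
  using assms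
proof (induction I rule: finite_induct)
  case (insert i I)
  have "sum f (A i \<union> (\<Union>i\<in>I. A i)) \<le> sum f (A i) + sum f (\<Union>i\<in>I. A i)"
    using insert by (subst sum_Un_nat) auto
  with insert show ?case by fastforce
qed simp

section \<open>Dot products and the two floor sums\<close>

lemma dotp_nonneg:
  assumes "\<forall>i\<in>{1..e-1}. 1 \<le> \<gamma> i"
  shows "0 \<le> dotp e \<gamma> x"
  unfolding dotp_def using assms by (intro sum_nonneg mult_nonneg_nonneg) force+

lemma dotp_mono:
  assumes "\<forall>i\<in>{1..e-1}. 1 \<le> \<gamma> i" and "vle e x y"
  shows "dotp e \<gamma> x \<le> dotp e \<gamma> y"
  unfolding dotp_def using assms by (intro sum_mono mult_right_mono) (force simp: vle_def)+

lemma dotp_diff: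
  assumes "vle e x y"
  shows "dotp e \<gamma> (y - x) = dotp e \<gamma> y - dotp e \<gamma> x"
  unfolding dotp_def sum_subtractf[symmetric]
  using assms by (intro sum.cong) (auto simp: vle_def lookup_minus of_nat_diff algebra_simps)

text \<open>One nonzero coordinate already contributes at least \<open>1 * 1\<close>, and the other
  summands are nonnegative.\<close>

lemma one_le_dotp:
  assumes "\<forall>i\<in>{1..e-1}. 1 \<le> \<gamma> i" and "x \<in> nvec e" "x \<noteq> 0"
  shows "1 \<le> dotp e \<gamma> x"
proof -
  obtain i where i: "Poly_Mapping.lookup x i \<noteq> 0"
    using \<open>x \<noteq> 0\<close> by (metis lookup_zero poly_mapping_eqI)
  then have ie: "i \<in> {1..e-1}"
    using lookup_nvec[OF \<open>x \<in> nvec e\<close>] by metis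
  have "1 * 1 \<le> of_nat (Poly_Mapping.lookup x i) * \<gamma> i"
    using i bspec[OF assms(1) ie] by (intro mult_mono) auto
  also have "\<dots> \<le> dotp e \<gamma> x"
    unfolding dotp_def using ie assms(1)
    by (intro member_le_sum mult_nonneg_nonneg) force+
  finally show ?thesis by simp
qed

text \<open>The denominator of the Wilf ratio, summed over elements instead of levels. Passing to
  \<open>nat\<close> loses nothing when all weights are at least 1.\<close>

definition dot_floor_sum :: "nat \<Rightarrow> (nat \<Rightarrow> rat) \<Rightarrow> (nat \<Rightarrow>\<^sub>0 nat) set \<Rightarrow> nat" where
  "dot_floor_sum e \<gamma> B = (\<Sum>b\<in>B. nat \<lfloor>dotp e \<gamma> b\<rfloor>)"

text \<open>The numerator in the same form; \<open>nat\<close> is harmless here because no element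
  of \<open>B\<close> exceeds the maximum.\<close>

definition codot_floor_sum :: "nat \<Rightarrow> (nat \<Rightarrow> rat) \<Rightarrow> (nat \<Rightarrow>\<^sub>0 nat) set \<Rightarrow> nat" where
  "codot_floor_sum e \<gamma> B = (\<Sum>b\<in>B. nat \<lfloor>max_dot e \<gamma> B - dotp e \<gamma> b\<rfloor>)"

lemma dotp_le_max_dot: "finite B \<Longrightarrow> b \<in> B \<Longrightarrow> dotp e \<gamma> b \<le> max_dot e \<gamma> B"
  unfolding max_dot_def by auto

lemma wilf_ratio_eq:
  assumes "finite B" and \<gamma>: "\<forall>i\<in>{1..e-1}. 1 \<le> \<gamma> i"
  shows "wilf_ratio e \<gamma> B = of_nat (codot_floor_sum e \<gamma> B) / of_nat (dot_floor_sum e \<gamma> B)"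
proof -
  let ?M = "max_dot e \<gamma> B" and ?N = "wilf_n0 e \<gamma> B"
  have nonneg: "0 \<le> \<lfloor>dotp e \<gamma> b\<rfloor>" for b
    using dotp_nonneg[OF \<gamma>] by simp
  have cononneg: "0 \<le> \<lfloor>?M - dotp e \<gamma> b\<rfloor>" if "b \<in> B" for b
    using dotp_le_max_dot[OF assms(1) that] by simp
  have le: "nat \<lfloor>dotp e \<gamma> b\<rfloor> \<le> ?N" if "b \<in> B" for b
    unfolding wilf_n0_def using dotp_le_max_dot[OF assms(1) that]
    by (intro nat_mono floor_mono)
  \<comment> \<open>This bound keeps the truncated subtraction from \<open>?N\<close> exact, both in
    rewriting \<open>wilf_h'\<close> and in \<open>?N - (?N - k) = k\<close>, which turns the weight
    \<open>?N - n\<close> back into the floor.\<close>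
  have cole: "nat \<lfloor>?M - dotp e \<gamma> b\<rfloor> \<le> ?N" for b
    unfolding wilf_n0_def using dotp_nonneg[OF \<gamma>] by (intro nat_mono floor_mono) simp
  have h: "wilf_h e \<gamma> B n = card {b \<in> B. nat \<lfloor>dotp e \<gamma> b\<rfloor> = n}" for n
    unfolding wilf_h_def by (rule arg_cong[where f = card]) (use nonneg in auto)
  have h': "wilf_h' e \<gamma> B n = card {b \<in> B. ?N - nat \<lfloor>?M - dotp e \<gamma> b\<rfloor> = n}" for n
    unfolding wilf_h'_def
  proof (intro arg_cong[where f = card] Collect_cong conj_cong refl)
    fix b assume "b \<in> B"
    then show "int ?N - \<lfloor>?M - dotp e \<gamma> b\<rfloor> = int n \<longleftrightarrow> ?N - nat \<lfloor>?M - dotp e \<gamma> b\<rfloor> = n"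
      using cononneg[of b] cole[of b] by linarith
  qed
  have "(\<Sum>n=0..?N. n * wilf_h e \<gamma> B n) = dot_floor_sum e \<gamma> B"
    unfolding h dot_floor_sum_def
    using assms(1) le by (rule sum_card_fibres[where g = "\<lambda>n. n"])
  moreover have "(\<Sum>n=0..?N. (?N - n) * wilf_h' e \<gamma> B n) = codot_floor_sum e \<gamma> B"
    unfolding h' codot_floor_sum_def
    by (subst sum_card_fibres[where g = "\<lambda>n. ?N - n"]) (use assms(1) cole in auto)
  ultimately show ?thesis
    by (simp add: wilf_ratio_def)
qed

section \<open>Reflection of cuboids and comparison of the sums\<close>

lemma max_dot_cuboid:
  assumes "\<forall>i\<in>{1..e-1}. 1 \<le> \<gamma> i" and "m \<in> nvec e" "finite (cuboid e m)"
  shows "max_dot e \<gamma> (cuboid e m) = dotp e \<gamma> m"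
  unfolding max_dot_def
  by (rule Max_eqI) (use assms in \<open>auto simp: cuboid_def vle_refl intro: dotp_mono\<close>)

text \<open>Reindexing by \<open>b \<mapsto> m - b\<close> replaces each dot product by its distance
  to that of \<open>m\<close>. The right side is the numerator of the cuboid once
  \<open>max_dot_cuboid\<close> is applied.\<close>

lemma dot_floor_sum_cuboid:
  assumes "m \<in> nvec e"
  shows "dot_floor_sum e \<gamma> (cuboid e m) = (\<Sum>b\<in>cuboid e m. nat \<lfloor>dotp e \<gamma> m - dotp e \<gamma> b\<rfloor>)"
proof -
  have "dot_floor_sum e \<gamma> (cuboid e m) = (\<Sum>b\<in>cuboid e m. nat \<lfloor>dotp e \<gamma> (m - b)\<rfloor>)"
    unfolding dot_floor_sum_def
    by (rule sum.reindex_bij_betw[OF bij_betw_cuboid_reflect[OF assms], symmetric])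
  also have "\<dots> = (\<Sum>b\<in>cuboid e m. nat \<lfloor>dotp e \<gamma> m - dotp e \<gamma> b\<rfloor>)"
    by (intro sum.cong) (auto simp: cuboid_def dotp_diff)
  finally show ?thesis .
qed

context order_ideal
begin

text \<open>A nonzero element of \<open>B\<close> has dot product at least 1. This guards the ratio
  against the convention that division by 0 yields 0.\<close>

lemma dot_floor_sum_pos:
  assumes "\<forall>i\<in>{1..e-1}. 1 \<le> \<gamma> i" and "B \<noteq> {0}"
  shows "0 < dot_floor_sum e \<gamma> B"
proof -
  obtain b where b: "b \<in> B" "b \<noteq> 0"
    using nonempty \<open>B \<noteq> {0}\<close> by blast
  then have "1 \<le> dotp e \<gamma> b"
    using one_le_dotp[OF assms(1)] subset by blast
  then have "0 < nat \<lfloor>dotp e \<gamma> b\<rfloor>"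
    by (simp add: less_floor_iff)
  with b(1) fin show ?thesis
    unfolding dot_floor_sum_def by (intro sum_pos2) auto
qed

lemma dot_floor_sum_le:
  assumes "\<forall>i\<in>{1..e-1}. 1 \<le> \<gamma> i"
  shows "dot_floor_sum e \<gamma> B \<le> card maximals * codot_floor_sum e \<gamma> B"
proof -
  have finQ: "finite (cuboid e m)" if "m \<in> maximals" for m
    using that cuboid_subset maximals_subset fin finite_subset by blast
  \<comment> \<open>The cuboids below the maximal elements cover \<open>B\<close> but may overlap,
    so only an inequality holds.\<close>
  have "dot_floor_sum e \<gamma> B \<le> (\<Sum>m\<in>maximals. dot_floor_sum e \<gamma> (cuboid e m))"
    unfolding dot_floor_sum_def
    by (subst Union_cuboids[symmetric]) (rule sum_UN_le_sum[OF finite_maximals finQ])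
  also have "\<dots> \<le> (\<Sum>m\<in>maximals. codot_floor_sum e \<gamma> B)"
  proof (rule sum_mono)
    fix m assume "m \<in> maximals"
    then have m: "m \<in> B" using maximals_subset by blast
    have "dot_floor_sum e \<gamma> (cuboid e m) = (\<Sum>b\<in>cuboid e m. nat \<lfloor>dotp e \<gamma> m - dotp e \<gamma> b\<rfloor>)"
      using m subset by (intro dot_floor_sum_cuboid) blast
    \<comment> \<open>Two enlargements follow: the value at \<open>m\<close> grows to the maximum
      over \<open>B\<close>, then the range of summation grows from the cuboid to
      \<open>B\<close>.\<close>
    also have "\<dots> \<le> (\<Sum>b\<in>cuboid e m. nat \<lfloor>max_dot e \<gamma> B - dotp e \<gamma> b\<rfloor>)"
      using dotp_le_max_dot[OF fin m] by (intro sum_mono nat_mono floor_mono) simp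
    also have "\<dots> \<le> codot_floor_sum e \<gamma> B"
      unfolding codot_floor_sum_def using cuboid_subset[OF m] fin by (intro sum_mono2) auto
    finally show "dot_floor_sum e \<gamma> (cuboid e m) \<le> codot_floor_sum e \<gamma> B" .
  qed
  also have "\<dots> = card maximals * codot_floor_sum e \<gamma> B"
    by simp
  finally show ?thesis .
qed

end

section \<open>The socle of \<open>R(B)\<close>\<close>

lemma poly_ring_simps:
  "carrier (poly_ring e) = {p. Poly_Mapping.keys p \<subseteq> nvec e}"
  "x \<otimes>\<^bsub>poly_ring e\<^esub> y = x * y" "x \<oplus>\<^bsub>poly_ring e\<^esub> y = x + y"
  "\<one>\<^bsub>poly_ring e\<^esub> = 1" "\<zero>\<^bsub>poly_ring e\<^esub> = 0"
  by (simp_all add: poly_ring_def)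

interpretation P: cring "poly_ring e" for e
  by (rule cring_poly_ring)

lemma poly_ring_uminus:
  assumes "p \<in> carrier (poly_ring e)"
  shows "\<ominus>\<^bsub>poly_ring e\<^esub> p = - p"
  by (rule P.minus_equality) (use assms in \<open>auto simp: poly_ring_simps\<close>)

lemma poly_ring_minus:
  assumes "p \<in> carrier (poly_ring e)" "q \<in> carrier (poly_ring e)"
  shows "p \<ominus>\<^bsub>poly_ring e\<^esub> q = p - q"
  using assms by (simp add: a_minus_def poly_ring_uminus poly_ring_simps)

lemma single_mem: "c \<in> nvec e \<Longrightarrow> Poly_Mapping.single c a \<in> carrier (poly_ring e)"
  by (auto simp: poly_ring_simps)

text \<open>Each exponent of a product is a sum of exponents of the factors, and \<open>C\<close>
  absorbs the addition of any exponent vector.\<close>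

lemma keys_ideal:
  assumes "C \<subseteq> nvec e" and closed: "\<And>c v. c \<in> C \<Longrightarrow> v \<in> nvec e \<Longrightarrow> c + v \<in> C"
  shows "ideal {p. Poly_Mapping.keys p \<subseteq> C} (poly_ring e)"
    (is "ideal ?S _")
proof (rule idealI)
  show "subgroup ?S (add_monoid (poly_ring e))"
  proof (rule P.add.subgroupI)
    show "?S \<subseteq> carrier (poly_ring e)"
      using assms(1) by (auto simp: poly_ring_simps)
    show "?S \<noteq> {}"
      by (auto intro: exI[of _ 0])
    fix p assume p: "p \<in> ?S"
    then have "p \<in> carrier (poly_ring e)"
      using assms(1) by (auto simp: poly_ring_simps)
    with p show "\<ominus>\<^bsub>poly_ring e\<^esub> p \<in> ?S"
      by (simp add: poly_ring_uminus)
    fix q assume "q \<in> ?S"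
    with p show "p \<oplus>\<^bsub>poly_ring e\<^esub> q \<in> ?S"
      using Poly_Mapping.keys_add[of p q] by (auto simp: poly_ring_simps)
  qed
  fix a x
  assume a: "a \<in> ?S" and x: "x \<in> carrier (poly_ring e)"
  have "Poly_Mapping.keys (a * x) \<subseteq> C"
    using keys_mult[of a x] a x closed by (fastforce simp: poly_ring_simps)
  then show "x \<otimes>\<^bsub>poly_ring e\<^esub> a \<in> ?S"
    and "a \<otimes>\<^bsub>poly_ring e\<^esub> x \<in> ?S"
    by (simp_all add: poly_ring_simps mult.commute)
qed (rule P.ring_axioms)

text \<open>One inclusion is minimality of the generated ideal among ideals containing the
  monomials. The other builds a polynomial term by term.\<close>

lemma mono_ideal_eq:
  assumes "C \<subseteq> nvec e" and "\<And>c v. c \<in> C \<Longrightarrow> v \<in> nvec e \<Longrightarrow> c + v \<in> C"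
  shows "mono_ideal e C = {p. Poly_Mapping.keys p \<subseteq> C}"
proof
  let ?G = "(\<lambda>c. Poly_Mapping.single c (1::complex)) ` C"
  have G: "?G \<subseteq> carrier (poly_ring e)"
    using assms(1) single_mem by blast
  interpret I: ideal "mono_ideal e C" "poly_ring e"
    unfolding mono_ideal_def using G by (rule P.genideal_ideal)
  show "mono_ideal e C \<subseteq> {p. Poly_Mapping.keys p \<subseteq> C}"
    unfolding mono_ideal_def using keys_ideal[OF assms] by (rule P.genideal_minimal) auto
  have "p \<in> mono_ideal e C" if "Poly_Mapping.keys p \<subseteq> C" for p
    using that
  proof (induction p rule: update_induct)
    case const
    show ?case using I.zero_closed by (simp add: poly_ring_simps)
  next
    case (update f c a)
    then have "c \<in> C" "f \<in> mono_ideal e C"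
      by (auto simp: keys_update)
    then have "Poly_Mapping.single c 1 \<in> mono_ideal e C"
      unfolding mono_ideal_def using P.genideal_self[OF G] by auto
    then have "Poly_Mapping.single 0 a \<otimes>\<^bsub>poly_ring e\<^esub> Poly_Mapping.single c 1 \<in> mono_ideal e C"
      by (rule I.I_l_closed) (rule single_mem[OF zero_in_nvec])
    then have "Poly_Mapping.single c a \<oplus>\<^bsub>poly_ring e\<^esub> f \<in> mono_ideal e C"
      using \<open>f \<in> mono_ideal e C\<close> by (intro I.a_closed) (simp_all add: poly_ring_simps mult_single)
    \<comment> \<open>Since \<open>c\<close> does not occur in \<open>f\<close>, setting its
      coefficient amounts to adding one term.\<close>
    moreover have "Poly_Mapping.update c a f = Poly_Mapping.single c a + f"
      using \<open>c \<notin> Poly_Mapping.keys f\<close>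
      by (intro poly_mapping_eqI)
        (auto simp: lookup_update lookup_add lookup_single in_keys_iff when_def)
    ultimately show ?case by (simp add: poly_ring_simps)
  qed
  then show "{p. Poly_Mapping.keys p \<subseteq> C} \<subseteq> mono_ideal e C"
    by blast
qed

text \<open>The constants are a copy of the complex numbers, with inverses taken coefficientwise;
  their image in the quotient is the field over which the type is measured.\<close>

lemma const_subfield: "subfield (range (Poly_Mapping.single 0)) (poly_ring e)"
proof (rule P.subfieldI)
  let ?K = "range (Poly_Mapping.single (0 :: nat \<Rightarrow>\<^sub>0 nat)) :: ((nat \<Rightarrow>\<^sub>0 nat) \<Rightarrow>\<^sub>0 complex) set"
  have K: "?K \<subseteq> carrier (poly_ring e)"
    using single_mem[OF zero_in_nvec] by blast
  show "subcring ?K (poly_ring e)"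
  proof (intro P.subcringI' P.subringI K)
    show "\<one>\<^bsub>poly_ring e\<^esub> \<in> ?K"
      by (auto simp: poly_ring_simps simp flip: single_one)
    show "\<ominus>\<^bsub>poly_ring e\<^esub> h \<in> ?K" if "h \<in> ?K" for h
    proof -
      have "\<ominus>\<^bsub>poly_ring e\<^esub> h = - h"
        using that K by (intro poly_ring_uminus) blast
      with that show ?thesis
        by (auto simp flip: single_uminus)
    qed
  qed (auto simp: poly_ring_simps mult_single simp flip: single_add)
  show "Units (poly_ring e\<lparr>carrier := ?K\<rparr>) = ?K - {\<zero>\<^bsub>poly_ring e\<^esub>}"
  proof (intro equalityI subsetI)
    fix x assume "x \<in> Units (poly_ring e\<lparr>carrier := ?K\<rparr>)"
    then show "x \<in> ?K - {\<zero>\<^bsub>poly_ring e\<^esub>}"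
      by (auto simp: Units_def poly_ring_simps)
  next
    fix x assume "x \<in> ?K - {\<zero>\<^bsub>poly_ring e\<^esub>}"
    then obtain a where a: "x = Poly_Mapping.single 0 a" "a \<noteq> 0"
      by (metis DiffE imageE poly_ring_simps(5) singletonI single_zero)
    then have "Poly_Mapping.single 0 (inverse a) * x = 1" "x * Poly_Mapping.single 0 (inverse a) = 1"
      by (simp_all add: mult_single)
    with a(1) show "x \<in> Units (poly_ring e\<lparr>carrier := ?K\<rparr>)"
      by (auto simp: Units_def poly_ring_simps)
  qed
qed

section \<open>The quotient ring and its scalars\<close>

context order_ideal
begin

abbreviation cls :: "((nat \<Rightarrow>\<^sub>0 nat) \<Rightarrow>\<^sub>0 complex) \<Rightarrow> ((nat \<Rightarrow>\<^sub>0 nat) \<Rightarrow>\<^sub>0 complex) set" where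
  "cls p \<equiv> mono_ideal e (nvec e - B) +>\<^bsub>poly_ring e\<^esub> p"

lemma mono_ideal_compl: "mono_ideal e (nvec e - B) = {p. Poly_Mapping.keys p \<subseteq> nvec e - B}"
  using compl_closed by (intro mono_ideal_eq) blast+

lemma ideal_compl: "ideal (mono_ideal e (nvec e - B)) (poly_ring e)"
  unfolding mono_ideal_compl using compl_closed by (intro keys_ideal) blast+

text \<open>Two classes agree when the difference has all exponents outside \<open>B\<close>. Hence
  the coefficients at \<open>B\<close> serve as coordinates on the quotient.\<close>

lemma cls_eq_iff:
  assumes "p \<in> carrier (poly_ring e)" "q \<in> carrier (poly_ring e)"
  shows "cls p = cls q \<longleftrightarrow> (\<forall>b\<in>B. Poly_Mapping.lookup p b = Poly_Mapping.lookup q b)"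
proof -
  have "p \<ominus>\<^bsub>poly_ring e\<^esub> q \<in> carrier (poly_ring e)"
    using assms by simp
  then have *: "Poly_Mapping.keys (p - q) \<subseteq> nvec e"
    using assms by (simp only: poly_ring_minus) (simp add: poly_ring_simps)
  have "cls p = cls q \<longleftrightarrow> p - q \<in> mono_ideal e (nvec e - B)"
    using P.quotient_eq_iff_same_a_r_cos[OF ideal_compl assms] assms by (simp add: poly_ring_minus)
  also have "\<dots> \<longleftrightarrow> (\<forall>b\<in>B. Poly_Mapping.lookup p b = Poly_Mapping.lookup q b)"
    unfolding mono_ideal_compl using * by (auto simp: in_keys_iff lookup_minus)
  finally show ?thesis .
qed

sublocale Q: cring "RB e B"
  unfolding RB_def by (rule ideal.quotient_is_cring[OF ideal_compl cring_poly_ring])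

sublocale H: ring_hom_ring "poly_ring e" "RB e B" cls
  unfolding RB_def by (rule ideal.rcos_ring_hom_ring[OF ideal_compl])

lemma cls_mult:
  "p \<in> carrier (poly_ring e) \<Longrightarrow> q \<in> carrier (poly_ring e) \<Longrightarrow> cls p \<otimes>\<^bsub>RB e B\<^esub> cls q = cls (p * q)"
  using H.hom_mult[of p q] by (simp add: poly_ring_simps)

lemma cls_add:
  "p \<in> carrier (poly_ring e) \<Longrightarrow> q \<in> carrier (poly_ring e) \<Longrightarrow> cls p \<oplus>\<^bsub>RB e B\<^esub> cls q = cls (p + q)"
  using H.hom_add[of p q] by (simp add: poly_ring_simps)

lemma cls_one: "\<one>\<^bsub>RB e B\<^esub> = cls 1"
  using H.hom_one by (simp add: poly_ring_simps)

lemma cls_zero: "\<zero>\<^bsub>RB e B\<^esub> = cls 0"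
  using H.hom_zero by (simp add: poly_ring_simps)

lemma carrier_RB: "carrier (RB e B) = cls ` carrier (poly_ring e)"
  unfolding RB_def FactRing_simps by auto

lemma one_mem: "1 \<in> carrier (poly_ring e)"
  using P.one_closed by (simp add: poly_ring_simps)

lemma zero_mem_poly: "0 \<in> carrier (poly_ring e)"
  using P.zero_closed by (simp add: poly_ring_simps)

text \<open>A ring homomorphism carries a subfield to a subfield unless the target is trivial; here
  1 and 0 differ in the coefficient at the exponent 0, which lies in \<open>B\<close>.\<close>

lemma subfield_RB_scalars: "subfield (RB_scalars e B) (RB e B)"
proof -
  have "\<one>\<^bsub>RB e B\<^esub> \<noteq> \<zero>\<^bsub>RB e B\<^esub>"
    unfolding cls_one cls_zero cls_eq_iff[OF one_mem zero_mem_poly]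
    using zero_mem by (auto simp: lookup_one)
  moreover have "RB_scalars e B = cls ` range (Poly_Mapping.single 0)"
    by (simp add: RB_scalars_def image_image)
  ultimately show ?thesis
    using H.img_is_subfield(2)[OF const_subfield] by simp
qed

section \<open>Monomial classes as a basis\<close>

text \<open>\<open>Span\<close> is built by one \<open>line_extension\<close> per list entry, so
  induction on the list adds one monomial with arbitrary coefficient at a time.\<close>

lemma Span_monomials:
  assumes "set bs \<subseteq> nvec e"
  shows "Q.Span (RB_scalars e B) (map (\<lambda>b. cls (Poly_Mapping.single b 1)) bs)
    = cls ` {p. Poly_Mapping.keys p \<subseteq> set bs}"
  using assms
proof (induction bs)
  case Nil
  then show ?case by (simp add: cls_zero)
next
  case (Cons b bs)
  have car: "p \<in> carrier (poly_ring e)" if "Poly_Mapping.keys p \<subseteq> set bs" for p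
    using that Cons.prems by (auto simp: poly_ring_simps)
  have b: "b \<in> nvec e" using Cons.prems by simp
  have scal: "cls (Poly_Mapping.single 0 a) \<otimes>\<^bsub>RB e B\<^esub> cls (Poly_Mapping.single b 1) \<oplus>\<^bsub>RB e B\<^esub> cls p
      = cls (Poly_Mapping.single b a + p)" if "Poly_Mapping.keys p \<subseteq> set bs" for a p
    using single_mem[OF zero_in_nvec, of a] single_mem[OF b] car[OF that]
    by (simp add: cls_mult mult_single cls_add)
  have "Q.Span (RB_scalars e B) (map (\<lambda>b. cls (Poly_Mapping.single b 1)) (b # bs))
    = Q.line_extension (RB_scalars e B) (cls (Poly_Mapping.single b 1))
        (cls ` {p. Poly_Mapping.keys p \<subseteq> set bs})"
    using Cons by simp
  also have "\<dots> = {cls (Poly_Mapping.single b a + p) | a p. Poly_Mapping.keys p \<subseteq> set bs}"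
  proof (rule Set.set_eqI)
    fix x
    have "x \<in> Q.line_extension (RB_scalars e B) (cls (Poly_Mapping.single b 1))
          (cls ` {p. Poly_Mapping.keys p \<subseteq> set bs})
      \<longleftrightarrow> (\<exists>a p. x = cls (Poly_Mapping.single 0 a) \<otimes>\<^bsub>RB e B\<^esub> cls (Poly_Mapping.single b 1)
            \<oplus>\<^bsub>RB e B\<^esub> cls p \<and> Poly_Mapping.keys p \<subseteq> set bs)"
      unfolding Q.line_extension_mem_iff RB_scalars_def by blast
    also have "\<dots> \<longleftrightarrow> (\<exists>a p. x = cls (Poly_Mapping.single b a + p) \<and> Poly_Mapping.keys p \<subseteq> set bs)"
      using scal by metis
    finally show "x \<in> Q.line_extension (RB_scalars e B) (cls (Poly_Mapping.single b 1))
          (cls ` {p. Poly_Mapping.keys p \<subseteq> set bs})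
      \<longleftrightarrow> x \<in> {cls (Poly_Mapping.single b a + p) | a p. Poly_Mapping.keys p \<subseteq> set bs}"
      by simp
  qed
  also have "\<dots> = cls ` {p. Poly_Mapping.keys p \<subseteq> set (b # bs)}"
  proof (intro equalityI subsetI)
    fix x assume "x \<in> {cls (Poly_Mapping.single b a + p) | a p. Poly_Mapping.keys p \<subseteq> set bs}"
    then obtain a p where x: "x = cls (Poly_Mapping.single b a + p)" "Poly_Mapping.keys p \<subseteq> set bs"
      by blast
    moreover have "Poly_Mapping.keys (Poly_Mapping.single b a + p) \<subseteq> set (b # bs)"
      using Poly_Mapping.keys_add[of "Poly_Mapping.single b a" p] x(2)
      by (auto split: if_splits)
    ultimately show "x \<in> cls ` {p. Poly_Mapping.keys p \<subseteq> set (b # bs)}"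
      by blast
  next
    fix x assume "x \<in> cls ` {p. Poly_Mapping.keys p \<subseteq> set (b # bs)}"
    then obtain p where x: "x = cls p" "Poly_Mapping.keys p \<subseteq> set (b # bs)"
      by blast
    \<comment> \<open>Erasing the coefficient at \<open>b\<close> splits \<open>p\<close> into its
      term at \<open>b\<close> and a part supported on \<open>bs\<close>.\<close>
    define q where "q = Poly_Mapping.update b 0 p"
    have "p = Poly_Mapping.single b (Poly_Mapping.lookup p b) + q"
      by (rule poly_mapping_eqI) (simp add: q_def lookup_add lookup_update lookup_single)
    moreover have "Poly_Mapping.keys q \<subseteq> set bs"
      using x(2) by (auto simp: q_def keys_update)
    ultimately show "x \<in> {cls (Poly_Mapping.single b a + p) | a p. Poly_Mapping.keys p \<subseteq> set bs}"
      unfolding mem_Collect_eq x(1) by metis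
  qed
  finally show ?case .
qed

text \<open>The coefficient at \<open>b\<close> is 1 for the new monomial and 0 for every
  combination of the others, and the quotient detects it because \<open>b\<close> lies in
  \<open>B\<close>.\<close>

lemma independent_monomials:
  assumes "set bs \<subseteq> B" "distinct bs"
  shows "Q.independent (RB_scalars e B) (map (\<lambda>b. cls (Poly_Mapping.single b 1)) bs)"
  using assms
proof (induction bs)
  case (Cons b bs)
  then have b: "b \<in> B" "b \<in> nvec e" and bs: "set bs \<subseteq> nvec e"
    using subset by auto
  have "cls (Poly_Mapping.single b 1) \<noteq> cls p" if p: "Poly_Mapping.keys p \<subseteq> set bs" for p
  proof -
    have "p \<in> carrier (poly_ring e)"
      using p bs by (auto simp: poly_ring_simps)
    moreover have "Poly_Mapping.lookup p b = 0"
      using p Cons.prems by (auto simp: in_keys_iff subset_iff)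
    ultimately show ?thesis
      using b by (auto simp: cls_eq_iff single_mem intro!: bexI[of _ b])
  qed
  then have "cls (Poly_Mapping.single b 1)
      \<notin> Q.Span (RB_scalars e B) (map (\<lambda>b. cls (Poly_Mapping.single b 1)) bs)"
    unfolding Span_monomials[OF bs] by blast
  moreover have "Q.independent (RB_scalars e B) (map (\<lambda>b. cls (Poly_Mapping.single b 1)) bs)"
    using Cons by simp
  ultimately show ?case
    unfolding list.map using H.hom_closed[OF single_mem[OF b(2)]] by (intro Q.li_Cons)
qed simp

lemma finite_dimension_RB: "Q.finite_dimension (RB_scalars e B) (carrier (RB e B))"
proof -
  obtain bs where bs: "set bs = B"
    using finite_list[OF fin] by blast
  let ?us = "map (\<lambda>b. cls (Poly_Mapping.single b 1)) bs"
  have us: "set ?us \<subseteq> carrier (RB e B)"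
    using bs subset single_mem by (auto simp: carrier_RB)
  have "carrier (RB e B) \<subseteq> Q.Span (RB_scalars e B) ?us"
  proof
    fix x assume "x \<in> carrier (RB e B)"
    then obtain p where p: "p \<in> carrier (poly_ring e)" "x = cls p"
      by (auto simp: carrier_RB)
    \<comment> \<open>The part of \<open>p\<close> supported on \<open>B\<close>: the discarded
      terms lie in the ideal, so the class is unchanged.\<close>
    define q where "q = (\<Sum>b\<in>B. Poly_Mapping.single b (Poly_Mapping.lookup p b))"
    have "Poly_Mapping.keys q \<subseteq> B"
      unfolding q_def using keys_sum[of "\<lambda>b. Poly_Mapping.single b (Poly_Mapping.lookup p b)" B]
      by (auto split: if_splits)
    moreover from this have "q \<in> carrier (poly_ring e)"
      using subset by (auto simp: poly_ring_simps)
    moreover have "Poly_Mapping.lookup q b = Poly_Mapping.lookup p b" if "b \<in> B" for b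
      using that fin by (simp add: q_def lookup_sum lookup_single when_def)
    ultimately have "cls p = cls q" "q \<in> {p. Poly_Mapping.keys p \<subseteq> B}"
      using p by (auto simp: cls_eq_iff)
    then show "x \<in> Q.Span (RB_scalars e B) ?us"
      using Span_monomials[of bs] bs subset p(2) by auto
  qed
  then have "carrier (RB e B) = Q.Span (RB_scalars e B) ?us"
    using Q.Span_in_carrier[OF _ us] subfieldE(3)[OF subfield_RB_scalars] by blast
  then show ?thesis
    using Q.Span_finite_dimension[OF subfield_RB_scalars us] by simp
qed

text \<open>The predicate \<open>subalgebra\<close> asks only for an additive subgroup closed under
  scalars, that is, a linear subspace. As a subspace of a finite-dimensional space the socle is then
  finite-dimensional.\<close>

lemma subalgebra_socle: "subalgebra (RB_scalars e B) (socle (RB e B)) (RB e B)"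
proof (intro subalgebra.intro subalgebra_axioms.intro Q.add.subgroupI)
  have J: "a \<in> carrier (RB e B)" if "a \<in> jacobson_radical (RB e B)" for a
    using that by (simp add: jacobson_radical_def)
  show "socle (RB e B) \<subseteq> carrier (RB e B)"
    by (auto simp: socle_def)
  have "\<zero>\<^bsub>RB e B\<^esub> \<in> socle (RB e B)"
    using J by (auto simp: socle_def)
  then show "socle (RB e B) \<noteq> {}" by blast
  fix x assume x: "x \<in> socle (RB e B)"
  then show "\<ominus>\<^bsub>RB e B\<^esub> x \<in> socle (RB e B)"
    using J by (auto simp: socle_def Q.r_minus)
  show "x \<oplus>\<^bsub>RB e B\<^esub> y \<in> socle (RB e B)" if "y \<in> socle (RB e B)" for y
    using that x J by (auto simp: socle_def Q.r_distr)
  show "k \<otimes>\<^bsub>RB e B\<^esub> x \<in> socle (RB e B)" if "k \<in> RB_scalars e B" for k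
  proof -
    have "k \<in> carrier (RB e B)"
      using that subfieldE(3)[OF subfield_RB_scalars] by blast
    moreover from this have "a \<otimes>\<^bsub>RB e B\<^esub> (k \<otimes>\<^bsub>RB e B\<^esub> x) = \<zero>\<^bsub>RB e B\<^esub>"
      if "a \<in> jacobson_radical (RB e B)" for a
      using that x J by (subst Q.m_lcomm) (simp_all add: socle_def)
    ultimately show ?thesis
      using x by (simp add: socle_def)
  qed
qed

section \<open>A maximal ideal and the monomials in the socle\<close>

text \<open>The ideal consists of the classes of polynomials without constant term. An ideal
  containing it and any further class contains a nonzero constant, hence 1.\<close>

lemma maximalideal_RB:
  "maximalideal (cls ` {p. Poly_Mapping.keys p \<subseteq> nvec e - {0}}) (RB e B)"
    (is "maximalideal ?M _")
proof (rule maximalidealI)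
  have nz: "c + v \<in> nvec e - {0}" if cv: "c \<in> nvec e - {0}" "v \<in> nvec e" for c v
  proof -
    obtain i where "Poly_Mapping.lookup c i \<noteq> 0"
      using cv(1) by (metis DiffE insertI1 lookup_zero poly_mapping_eqI)
    then have "Poly_Mapping.lookup (c + v) i \<noteq> 0"
      by (simp add: lookup_add)
    with cv show ?thesis
      by (auto simp: nvec_add)
  qed
  have car: "p \<in> carrier (poly_ring e)" if "Poly_Mapping.keys p \<subseteq> nvec e - {0}" for p
    using that by (auto simp: poly_ring_simps)
  show M: "ideal ?M (RB e B)"
    unfolding RB_def using nz
    by (intro P.ring_ideal_imp_quot_ideal ideal_compl keys_ideal) auto
  have "cls 1 \<noteq> cls p" if "Poly_Mapping.keys p \<subseteq> nvec e - {0}" for p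
  proof -
    have "Poly_Mapping.lookup p 0 = 0"
      using that by (auto simp: in_keys_iff subset_iff)
    then show ?thesis
      using zero_mem by (auto simp: cls_eq_iff[OF one_mem car[OF that]] intro!: bexI[of _ 0])
  qed
  then have "\<one>\<^bsub>RB e B\<^esub> \<notin> ?M"
    by (auto simp: cls_one)
  then show "carrier (RB e B) \<noteq> ?M"
    by blast
  fix J assume J: "ideal J (RB e B)" "?M \<subseteq> J" "J \<subseteq> carrier (RB e B)"
  interpret J: ideal J "RB e B" by fact
  show "J = ?M \<or> J = carrier (RB e B)"
  proof (rule disjCI)
    assume "J \<noteq> carrier (RB e B)"
    then have one: "\<one>\<^bsub>RB e B\<^esub> \<notin> J"
      using J.one_imp_carrier by blast
    have "x \<in> ?M" if x: "x \<in> J" for x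
    proof -
      obtain p where p: "p \<in> carrier (poly_ring e)" "x = cls p"
        using J(3) x by (auto simp: carrier_RB)
      define q where "q = Poly_Mapping.update 0 0 p"
      let ?a = "Poly_Mapping.lookup p 0"
      have q: "Poly_Mapping.keys q \<subseteq> nvec e - {0}"
        using p(1) by (auto simp: q_def keys_update poly_ring_simps)
      have pq: "p = Poly_Mapping.single 0 ?a + q"
        by (rule poly_mapping_eqI) (simp add: q_def lookup_add lookup_update lookup_single)
      show ?thesis
      proof (cases "?a = 0")
        case True
        then have "p = q" using pq by simp
        with p(2) q show ?thesis by blast
      next
        case False
        have s: "Poly_Mapping.single 0 a \<in> carrier (poly_ring e)" for a
          by (rule single_mem[OF zero_in_nvec])
        have "cls q \<in> J" using J(2) q by blast
        \<comment> \<open>Subtracting the part without constant term leaves the constant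
          \<open>?a\<close> in \<open>J\<close>, which is invertible.\<close>
        then have "x \<ominus>\<^bsub>RB e B\<^esub> cls q \<in> J"
          using x by (simp add: a_minus_def)
        moreover have "x = cls (Poly_Mapping.single 0 ?a) \<oplus>\<^bsub>RB e B\<^esub> cls q"
          unfolding p(2) using pq cls_add[OF s car[OF q]] by metis
        then have "x \<ominus>\<^bsub>RB e B\<^esub> cls q = cls (Poly_Mapping.single 0 ?a)"
          using H.hom_closed[OF s] H.hom_closed[OF car[OF q]]
          by (simp add: a_minus_def Q.a_assoc Q.r_neg)
        ultimately have "cls (Poly_Mapping.single 0 (inverse ?a)) \<otimes>\<^bsub>RB e B\<^esub> cls (Poly_Mapping.single 0 ?a) \<in> J"
          using J.I_l_closed H.hom_closed[OF s] by metis
        then have "\<one>\<^bsub>RB e B\<^esub> \<in> J"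
          using False by (simp add: cls_mult s mult_single cls_one)
        with one show ?thesis by contradiction
      qed
    qed
    with J(2) show "J = ?M" by blast
  qed
qed

text \<open>The Jacobson radical lies in the maximal ideal above, so its elements have
  representatives without constant term. Multiplying by the monomial of \<open>m\<close> pushes
  every exponent strictly above \<open>m\<close>, hence out of \<open>B\<close>.\<close>

lemma maximal_monomial_in_socle:
  assumes "m \<in> maximals"
  shows "cls (Poly_Mapping.single m 1) \<in> socle (RB e B)"
proof -
  have m: "m \<in> nvec e" using assms maximals_subset subset by blast
  have "a \<otimes>\<^bsub>RB e B\<^esub> cls (Poly_Mapping.single m 1) = \<zero>\<^bsub>RB e B\<^esub>" if "a \<in> jacobson_radical (RB e B)" for a
  proof -
    have "a \<in> cls ` {p. Poly_Mapping.keys p \<subseteq> nvec e - {0}}"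
      using that maximalideal_RB unfolding jacobson_radical_def by blast
    then obtain p where p: "a = cls p" "Poly_Mapping.keys p \<subseteq> nvec e - {0}"
      by blast
    have pc: "p \<in> carrier (poly_ring e)"
      using p(2) by (auto simp: poly_ring_simps)
    let ?pm = "p * Poly_Mapping.single m 1"
    have "Poly_Mapping.keys ?pm \<subseteq> {b + m | b. b \<in> Poly_Mapping.keys p}"
      using keys_mult[of p "Poly_Mapping.single m 1"] by auto
    also have "\<dots> \<subseteq> - B"
      using add_maximal_notin[OF assms] p(2) by (auto simp: add.commute)
    finally have "Poly_Mapping.lookup ?pm b = 0" if "b \<in> B" for b
      using that by (auto simp: in_keys_iff subset_iff)
    moreover have "?pm \<in> carrier (poly_ring e)"
      using P.m_closed[OF pc single_mem[OF m]] by (simp add: poly_ring_simps)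
    ultimately show ?thesis
      by (simp add: p(1) cls_mult[OF pc single_mem[OF m]] cls_zero cls_eq_iff zero_mem_poly)
  qed
  then show ?thesis
    using H.hom_closed[OF single_mem[OF m]] by (auto simp: socle_def)
qed

text \<open>The monomials of the maximal elements are independent in the socle, so their number is
  bounded by its dimension. Finite dimensionality ensures that \<open>cm_type\<close> is a genuine
  dimension.\<close>

lemma card_maximals_le_cm_type: "card maximals \<le> cm_type e B"
proof -
  obtain ms where ms: "set ms = maximals" "distinct ms"
    using finite_distinct_list[OF finite_maximals] by blast
  have "socle (RB e B) \<subseteq> carrier (RB e B)"
    by (auto simp: socle_def)
  then have "Q.finite_dimension (RB_scalars e B) (socle (RB e B))"
    using Q.subalbegra_incl_imp_finite_dimension[OF subfield_RB_scalars finite_dimension_RB subalgebra_socle]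
    by blast
  then have "Q.dimension (cm_type e B) (RB_scalars e B) (socle (RB e B))"
    unfolding cm_type_def by (rule Q.finite_dimensionE[OF subfield_RB_scalars])
  moreover have "Q.independent (RB_scalars e B) (map (\<lambda>b. cls (Poly_Mapping.single b 1)) ms)"
    using ms maximals_subset by (intro independent_monomials) auto
  moreover have "set (map (\<lambda>b. cls (Poly_Mapping.single b 1)) ms) \<subseteq> socle (RB e B)"
    using ms maximal_monomial_in_socle by auto
  ultimately have "length (map (\<lambda>b. cls (Poly_Mapping.single b 1)) ms) \<le> cm_type e B"
    by (rule Q.independent_length_le_dimension[OF subfield_RB_scalars])
  with ms show ?thesis
    by (simp flip: distinct_card)
qed

end

section \<open>Both claims from the two sums\<close>

theorem mainTheorem1:
  fixes e :: nat and \<gamma> :: "nat \<Rightarrow> rat" and B C :: "(nat \<Rightarrow>\<^sub>0 nat) set"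
  assumes "e \<ge> 2"
    and "1 \<le> \<gamma> 1"
    and "\<forall>i\<in>{1..e-1}. \<forall>j\<in>{1..e-1}. i \<le> j \<longrightarrow> \<gamma> i \<le> \<gamma> j"
    and "B \<subseteq> nvec e" and "finite B" and "B \<noteq> {}" and "B \<noteq> {0}"
    and "C = nvec e - B"
    and "\<forall>c\<in>C. \<forall>v\<in>nvec e. c + v \<in> C"
  shows "wilf_ratio e \<gamma> B \<ge> 1 / of_nat (cm_type e B)
    \<and> ((\<exists>m\<in>nvec e. B = cuboid e m) \<longrightarrow> wilf_ratio e \<gamma> B = 1)"
proof (intro conjI impI)
  interpret order_ideal e B
    using assms by unfold_locales auto
  have \<gamma>: "\<forall>i\<in>{1..e-1}. 1 \<le> \<gamma> i"
  proof
    fix i assume "i \<in> {1..e-1}"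
    then have "\<gamma> 1 \<le> \<gamma> i" using assms(1,3) by auto
    with assms(2) show "1 \<le> \<gamma> i" by simp
  qed
  let ?D = "dot_floor_sum e \<gamma> B" and ?N = "codot_floor_sum e \<gamma> B" and ?t = "cm_type e B"
  have D: "0 < ?D"
    using dot_floor_sum_pos[OF \<gamma>] assms(7) by blast
  have ratio: "wilf_ratio e \<gamma> B = of_nat ?N / of_nat ?D"
    by (rule wilf_ratio_eq[OF fin \<gamma>])
  have "?D \<le> ?t * ?N"
    using dot_floor_sum_le[OF \<gamma>] card_maximals_le_cm_type by (meson le_trans mult_le_mono1)
  then have le: "rat_of_nat ?D \<le> of_nat ?t * of_nat ?N"
    by (simp only: of_nat_le_iff flip: of_nat_mult)
  \<comment> \<open>If the type were 0, the positive denominator would be bounded by 0. Positivity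
    permits clearing both denominators.\<close>
  have "0 < ?t"
    using D \<open>?D \<le> ?t * ?N\<close> by (cases "?t = 0") auto
  with D le show "wilf_ratio e \<gamma> B \<ge> 1 / of_nat ?t"
    unfolding ratio by (simp add: field_simps)
  assume "\<exists>m\<in>nvec e. B = cuboid e m"
  then obtain m where m: "m \<in> nvec e" "B = cuboid e m" by blast
  then have "max_dot e \<gamma> B = dotp e \<gamma> m"
    using max_dot_cuboid[OF \<gamma>] fin by blast
  \<comment> \<open>For a cuboid the maximum is attained at its corner \<open>m\<close>, so the
    reflected sum is the numerator itself.\<close>
  then have "?D = ?N"
    using dot_floor_sum_cuboid[OF m(1)] m(2) by (simp add: codot_floor_sum_def)
  with D show "wilf_ratio e \<gamma> B = 1"
    by (simp add: ratio)
qed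

end
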